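(* Let $k\ge 1$ and let $P=p_1p_2\cdots p_k$ and $Q=q_1q_2\cdots q_k$ be alternating permutations in $A_k$. For $n\ge k$ let $A^{P}(n)$ be the set of alternating permutations $\sigma\in A_n$ whose prefix $\sigma_1\sigma_2\cdots\sigma_k$ is order-isomorphic to $P$, and let $f^{P}(x)=\sum_{n\ge k}|A^{P}(n)|\,\frac{x^n}{n!}$, and similarly $f^{Q}$. If $p_k=q_k$, then $f^{P}=f^{Q}$, i.e. $|A^{P}(n)|=|A^{Q}(n)|$ for all $n\ge k$.
   Context: A permutation $\sigma=\sigma_1\cdots\sigma_n$ of $\{1,\dots,n\}$ is alternating (up-down) if $\sigma_1<\sigma_2>\sigma_3<\sigma_4>\cdots$; $A_n$ denotes the set of alternating permutations of length $n$. A sequence of distinct integers is order-isomorphic to a permutation $P$ of the same length if its entries are in the same relative order as the entries of $P$. *)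

theory Defs
  imports "HOL-Combinatorics.Multiset_Permutations" "HOL-Computational_Algebra.Formal_Power_Series"
begin

text \<open>
  A permutation of \<open>{1..n}\<close> is a list in one-line notation. List positions are 0-based, so
  \<open>\<sigma>\<^sub>1 < \<sigma>\<^sub>2\<close> is the comparison of positions \<open>0\<close> and \<open>1\<close>: ascents are at even positions.
\<close>

definition alternating :: "nat list \<Rightarrow> bool" where
  "alternating xs \<longleftrightarrow>
     (\<forall>i. Suc i < length xs \<longrightarrow>
        (if even i then xs ! i < xs ! Suc i else xs ! i > xs ! Suc i))"

definition alternating_perms :: "nat \<Rightarrow> nat list set" where
  "alternating_perms n = {\<sigma> \<in> permutations_of_set {1..n}. alternating \<sigma>}"

definition order_isomorphic :: "nat list \<Rightarrow> nat list \<Rightarrow> bool" where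
  "order_isomorphic xs ys \<longleftrightarrow>
     length xs = length ys \<and>
     (\<forall>i<length xs. \<forall>j<length xs. xs ! i < xs ! j \<longleftrightarrow> ys ! i < ys ! j)"

definition alternating_perms_prefix :: "nat list \<Rightarrow> nat \<Rightarrow> nat list set" where
  "alternating_perms_prefix P n =
     {\<sigma> \<in> alternating_perms n. order_isomorphic (take (length P) \<sigma>) P}"

definition prefix_egf :: "nat list \<Rightarrow> real fps" where
  "prefix_egf P =
     Abs_fps (\<lambda>n. if length P \<le> n
                   then real (card (alternating_perms_prefix P n)) / fact n else 0)"

end

theory Submission
  imports Defs
begin

text \<open>
  Since \<open>P\<close> and \<open>Q\<close> are rearrangements of each other, some permutation of the first \<open>k\<close>
  positions turns \<open>P\<close> into \<open>Q\<close>. Applied to the prefix of \<open>\<sigma>\<close>, it gives an injection from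
  \<open>A\<^sup>P(n)\<close> into \<open>A\<^sup>Q(n)\<close>: inside the prefix the comparisons become those of \<open>Q\<close>, and the junction
  with the rest of \<open>\<sigma>\<close> is unaffected because \<open>p\<^sub>k = q\<^sub>k\<close> means that the last position is fixed.
  Exchanging \<open>P\<close> and \<open>Q\<close> gives equality.
\<close>

lemma permute_list_alternating_perms_prefix:
  assumes \<pi>: "\<pi> permutes {..<length P}" and Q: "permute_list \<pi> P = Q"
    and fix_last: "\<pi> (length P - 1) = length P - 1"
    and altQ: "alternating Q" and n: "length P \<le> n"
    and \<sigma>: "\<sigma> \<in> alternating_perms_prefix P n"
  shows "permute_list \<pi> \<sigma> \<in> alternating_perms_prefix Q n"
proof -
  let ?k = "length P" and ?\<tau> = "permute_list \<pi> \<sigma>"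
  have \<sigma>_perm: "\<sigma> \<in> permutations_of_set {1..n}" and alt\<sigma>: "alternating \<sigma>"
    and iso: "order_isomorphic (take ?k \<sigma>) P"
    using \<sigma> by (auto simp: alternating_perms_prefix_def alternating_perms_def)
  have len: "length \<sigma> = n"
    using length_finite_permutations_of_set[OF \<sigma>_perm] by simp
  have lenQ: "length Q = ?k"
    using Q by auto
  \<comment> \<open>Outside the first \<open>?k\<close> positions \<pi> is the identity, so the same
    function permutes all positions of \<sigma>.\<close>
  have \<pi>n: "\<pi> permutes {..<length \<sigma>}"
    using permutes_subset[OF \<pi>, of "{..<n}"] n len by auto
  have \<tau>_nth: "?\<tau> ! i = \<sigma> ! \<pi> i" if "i < n" for i
    using permute_list_nth[OF \<pi>n] that len by simp
  have Q_nth: "Q ! i = P ! \<pi> i" if "i < ?k" for i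
    using permute_list_nth[OF \<pi>] that Q by simp
  have \<pi>_less: "\<pi> i < ?k" if "i < ?k" for i
    using permutes_in_image[OF \<pi>, of i] that by simp
  \<comment> \<open>The bound is \<open>Suc i\<close> rather than \<open>i\<close> so that the last
    prefix position, the left end of the junction, is included.\<close>
  have \<pi>_fix: "\<pi> i = i" if "?k \<le> Suc i" for i
  proof (cases "i < ?k")
    case True
    with that have "i = ?k - 1" by simp
    with fix_last show ?thesis by simp
  next
    case False
    then show ?thesis using permutes_not_in[OF \<pi>] by simp
  qed
  have iso_nth: "\<sigma> ! i < \<sigma> ! j \<longleftrightarrow> P ! i < P ! j" if "i < ?k" "j < ?k" for i j
    using iso that n len by (simp add: order_isomorphic_def)
  \<comment> \<open>Both sides compare positions \<open>\<pi> i\<close> and \<open>\<pi> j\<close>,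
    in \<sigma> and in \<open>P\<close> respectively; these stay inside the prefix, where \<sigma>
    is ordered like \<open>P\<close>.\<close>
  have cmp: "?\<tau> ! i < ?\<tau> ! j \<longleftrightarrow> Q ! i < Q ! j" if "i < ?k" "j < ?k" for i j
    using that n by (simp add: \<tau>_nth Q_nth iso_nth \<pi>_less)
  have "mset ?\<tau> = mset \<sigma>"
    using \<pi>n by simp
  then have "?\<tau> \<in> permutations_of_set {1..n}"
    using \<sigma>_perm mset_eq_imp_distinct_iff mset_eq_setD
    unfolding permutations_of_set_def by blast
  moreover have "alternating ?\<tau>"
    unfolding alternating_def
  proof (intro allI impI)
    fix i assume i: "Suc i < length ?\<tau>"
    show "if even i then ?\<tau> ! i < ?\<tau> ! Suc i else ?\<tau> ! i > ?\<tau> ! Suc i"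
    \<comment> \<open>Either both positions lie in the prefix, where the pattern of \<open>Q\<close>
      decides, or \<pi> fixes both and \<sigma> decides; the junction \<open>i = ?k - 1\<close>
      falls under the latter.\<close>
    proof (cases "Suc i < ?k")
      case True
      then show ?thesis
        using altQ cmp[of i "Suc i"] cmp[of "Suc i" i] lenQ by (simp add: alternating_def)
    next
      case False
      then have "?\<tau> ! i = \<sigma> ! i" "?\<tau> ! Suc i = \<sigma> ! Suc i"
        using i len by (simp_all add: \<tau>_nth \<pi>_fix)
      then show ?thesis
        using alt\<sigma> i by (simp add: alternating_def)
    qed
  qed
  moreover have "order_isomorphic (take (length Q) ?\<tau>) Q"
    using cmp lenQ len n by (simp add: order_isomorphic_def)
  ultimately show ?thesis
    by (simp add: alternating_perms_prefix_def alternating_perms_def)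
qed

lemma card_alternating_perms_prefix_le:
  assumes "k \<ge> 1" and P: "P \<in> alternating_perms k" and Q: "Q \<in> alternating_perms k"
    and last: "P ! (k - 1) = Q ! (k - 1)" and n: "k \<le> n"
  shows "card (alternating_perms_prefix P n) \<le> card (alternating_perms_prefix Q n)"
proof -
  have P_perm: "P \<in> permutations_of_set {1..k}" and Q_perm: "Q \<in> permutations_of_set {1..k}"
    and altQ: "alternating Q"
    using P Q by (auto simp: alternating_perms_def)
  have lenP: "length P = k"
    using length_finite_permutations_of_set[OF P_perm] by simp
  have "mset Q = mset P"
    using P_perm Q_perm by (metis permutations_of_setD set_eq_iff_mset_eq_distinct)
  then obtain \<pi> where \<pi>: "\<pi> permutes {..<length P}" and PQ: "permute_list \<pi> P = Q"
    by (rule mset_eq_permutation)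
  \<comment> \<open>This is where equality of the last entries enters: as \<open>P\<close> has
    distinct entries, \<pi> must fix position \<open>k - 1\<close>, a genuine position because
    \<open>k \<ge> 1\<close>.\<close>
  have "P ! \<pi> (k - 1) = P ! (k - 1)"
    using permute_list_nth[OF \<pi>, of "k - 1"] PQ last lenP \<open>k \<ge> 1\<close> by simp
  moreover have "\<pi> (k - 1) < k"
    using permutes_in_image[OF \<pi>, of "k - 1"] lenP \<open>k \<ge> 1\<close> by simp
  ultimately have fix_last: "\<pi> (length P - 1) = length P - 1"
    using permutations_of_setD(2)[OF P_perm] lenP \<open>k \<ge> 1\<close> by (simp add: nth_eq_iff_index_eq)
  have inj: "inj_on (permute_list \<pi>) (alternating_perms_prefix P n)"
  proof (rule inj_onI)
    fix \<sigma> \<sigma>'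
    assume "\<sigma> \<in> alternating_perms_prefix P n" "\<sigma>' \<in> alternating_perms_prefix P n"
      and eq: "permute_list \<pi> \<sigma> = permute_list \<pi> \<sigma>'"
    then have len: "length \<sigma> = n" "length \<sigma>' = n"
      using length_finite_permutations_of_set[of _ "{1..n}"]
      by (auto simp: alternating_perms_prefix_def alternating_perms_def)
    have \<pi>n: "\<pi> permutes {..<n}"
      using permutes_subset[OF \<pi>, of "{..<n}"] n lenP by auto
    show "\<sigma> = \<sigma>'"
    proof (rule nth_equalityI)
      fix i assume i: "i < length \<sigma>"
      \<comment> \<open>By surjectivity of \<pi>, the entry at \<open>i\<close> of either list is
        the entry at \<open>j\<close> of the common image.\<close>
      then obtain j where j: "j < n" "i = \<pi> j"
        using permutes_image[OF \<pi>n] len by (metis imageE lessThan_iff)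
      then show "\<sigma> ! i = \<sigma>' ! i"
        using permute_list_nth[of \<pi> \<sigma> j] permute_list_nth[of \<pi> \<sigma>' j] \<pi>n len eq by simp
    qed (simp add: len)
  qed
  have "finite (alternating_perms_prefix Q n)"
    by (simp add: alternating_perms_prefix_def alternating_perms_def)
  moreover have "permute_list \<pi> ` alternating_perms_prefix P n \<subseteq> alternating_perms_prefix Q n"
    using permute_list_alternating_perms_prefix[OF \<pi> PQ fix_last altQ] n lenP by blast
  ultimately show ?thesis
    using inj by (meson card_inj_on_le)
qed

theorem theorem1:
  fixes k :: nat and P Q :: "nat list"
  assumes "k \<ge> 1"
    and "P \<in> alternating_perms k"
    and "Q \<in> alternating_perms k"
    and "P ! (k - 1) = Q ! (k - 1)"
  shows "prefix_egf P = prefix_egf Q \<and>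
    (\<forall>n\<ge>k. card (alternating_perms_prefix P n) = card (alternating_perms_prefix Q n))"
proof -
  have eq: "card (alternating_perms_prefix P n) = card (alternating_perms_prefix Q n)"
    if "n \<ge> k" for n
    using card_alternating_perms_prefix_le assms that by (metis le_antisym)
  moreover have "length P = k" "length Q = k"
    using assms length_finite_permutations_of_set[of _ "{1..k}"]
    by (auto simp: alternating_perms_def)
  \<comment> \<open>Since \<open>P\<close> and \<open>Q\<close> have equal length, the coefficients
    below \<open>k\<close> vanish in both series; the others agree by \<open>eq\<close>.\<close>
  ultimately show ?thesis
    by (simp add: prefix_egf_def fps_eq_iff)
qed

end
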